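(* Let $k, q$ be integers with $1 < k \leq q$, let $I$ be the $q \times q$ identity matrix with columns $e_1, \ldots, e_q$, and let $q = \sum_{j=1}^k q_j$ with integers $q_j \geq 1$. Let $S_1, \ldots, S_k$ be a partition of $\{1, \ldots, q\}$ into disjoint sets with $|S_j| = q_j$, and let $B = [b_1, \ldots, b_k] \in \mathbb{R}^{q \times k}$ be the column stochastic matrix with columns $b_j = \frac{1}{q_j} \sum_{i \in S_j} e_i$ (the center of the sub-simplex with vertices $e_i$, $i \in S_j$). Then there is a column stochastic matrix $A \in \mathbb{R}^{k \times q}$ such that $$\lVert I - BA \rVert^2 = \sum_{j=1}^k (q_j - 1) = q - k.$$
   Context: All matrices are real and $\lVert M \rVert$ denotes the Frobenius norm, $\lVert M \rVert^2 = \sum_{i,j} m_{ij}^2$. A matrix is column stochastic if each of its columns has nonnegative entries summing to $1$. *)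

theory Defs
  imports "HOL-Analysis.Analysis"
begin

definition column_stochastic :: "real ^ 'n ^ 'm \<Rightarrow> bool" where
  "column_stochastic M \<longleftrightarrow>
     (\<forall>j. (\<forall>i. 0 \<le> M $ i $ j) \<and> (\<Sum>i\<in>UNIV. M $ i $ j) = 1)"

text \<open>The library norm on \<^typ>\<open>real ^ 'n ^ 'm\<close> is the Frobenius norm, not an operator norm.\<close>

lemma norm_matrix_sq:
  fixes M :: "real ^ 'n ^ 'm"
  shows "(norm M)\<^sup>2 = (\<Sum>i\<in>UNIV. \<Sum>j\<in>UNIV. (M $ i $ j)\<^sup>2)"
  by (simp add: norm_vec_def L2_set_def sum_nonneg)

lemma column_stochastic_centers:
  fixes S :: "'k::finite \<Rightarrow> 'q::finite set" and B :: "real ^ 'k ^ 'q"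
  assumes "\<And>j. card (S j) \<ge> 1"
    and "\<And>j. column j B = (1 / real (card (S j))) *\<^sub>R (\<Sum>i\<in>S j. axis i 1)"
  shows "column_stochastic B"
proof -
  have B: "B $ i $ j = (if i \<in> S j then 1 / real (card (S j)) else 0)" for i j
  proof -
    have "B $ i $ j = column j B $ i" by (simp add: column_def)
    also have "\<dots> = (1 / real (card (S j))) * (\<Sum>l\<in>S j. if l = i then 1 else 0)"
      unfolding assms(2) by (simp add: axis_def eq_commute)
    finally show ?thesis by simp
  qed
  show ?thesis
    unfolding column_stochastic_def B
    using assms(1) by (auto simp: sum.If_cases Suc_le_eq card_gt_0_iff)
qed

end

theory Submission
  imports Defs
begin

text \<open>
  Take for \<open>A\<close> the membership matrix of the partition: its column \<open>l\<close> is the unit vector \<open>e_j\<close> of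
  the block \<open>S j\<close> containing \<open>l\<close>. Then \<open>B ** A\<close> sends each \<open>e_l\<close> to the center of the block of \<open>l\<close>.
  In other words, it is the orthogonal projection that averages a vector over each block, so
  \<open>I - B ** A\<close> is again an orthogonal projection and its squared Frobenius norm is its trace, the
  sum over the blocks of \<open>q_j - 1\<close>.

  The proof gets this number row by row instead of through the trace: each of the \<open>q_j\<close> rows
  with index in \<open>S j\<close> is the difference of a vertex of a sub-simplex and its center, of
  squared length \<open>1 - 1 / q_j\<close> (\<open>dist_vertex_center_sq\<close>).
\<close>

lemma center_column_entry:
  fixes B :: "real ^ 'k ^ 'q" and T :: "'q::finite set"
  assumes "column j B = c *\<^sub>R (\<Sum>i\<in>T. axis i 1)"
  shows "B $ i $ j = (if i \<in> T then c else 0)"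
proof -
  have "B $ i $ j = column j B $ i"
    by (simp add: column_def)
  also have "\<dots> = c * (\<Sum>l\<in>T. if l = i then 1 else 0)"
    unfolding assms by (simp add: axis_def eq_commute)
  finally show ?thesis
    by simp
qed

text \<open>
  Expanding the square leaves three sums: \<open>1\<close> for the vertex, \<open>- 2 / card T\<close> for the cross term
  and \<open>card T * (1 / card T)\<^sup>2\<close> for the center.
\<close>

lemma dist_vertex_center_sq:
  fixes T :: "'q::finite set"
  assumes "i \<in> T"
  shows "(\<Sum>l\<in>UNIV. ((if i = l then 1 else 0) - (if l \<in> T then 1 / real (card T) else 0))\<^sup>2)
           = 1 - 1 / real (card T)"
proof -
  define c where "c = 1 / real (card T)"
  have T: "real (card T) > 0"
    using assms by (auto simp: card_gt_0_iff)
  have "(\<Sum>l\<in>UNIV. ((if i = l then 1 else 0) - (if l \<in> T then c else 0))\<^sup>2)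
          = (\<Sum>l\<in>UNIV. (if i = l then 1 - 2 * c else 0) + (if l \<in> T then c\<^sup>2 else 0))"
    using assms by (intro sum.cong) (auto simp: power2_eq_square algebra_simps)
  also have "\<dots> = (1 - 2 * c) + real (card T) * c\<^sup>2"
    by (simp add: sum.distrib sum.If_cases)
  also have "\<dots> = 1 - c"
    using T by (simp add: c_def power2_eq_square field_simps)
  finally show ?thesis
    unfolding c_def .
qed

theorem mainTheorem5:
  fixes qs :: "'k::finite \<Rightarrow> nat"
    and S :: "'k \<Rightarrow> 'q::finite set"
    and B :: "real ^ 'k ^ 'q"
  assumes "1 < CARD('k)"
    and "CARD('k) \<le> CARD('q)"
    and "\<And>j. qs j \<ge> 1"
    and "CARD('q) = (\<Sum>j\<in>UNIV. qs j)"
    and "(\<Union>j. S j) = UNIV"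
    and "disjoint_family S"
    and "\<And>j. card (S j) = qs j"
    and "\<And>j. column j B = (1 / real (qs j)) *\<^sub>R (\<Sum>i\<in>S j. axis i 1)"
  shows "\<exists>A :: real ^ 'q ^ 'k. column_stochastic A \<and>
           (norm (mat 1 - B ** A))\<^sup>2 = (\<Sum>j\<in>UNIV. real (qs j) - 1) \<and>
           (\<Sum>j\<in>UNIV. real (qs j) - 1) = real CARD('q) - real CARD('k)"
proof -
  define A :: "real ^ 'q ^ 'k" where "A = (\<chi> j l. if l \<in> S j then 1 else 0)"
  have mem_iff: "l \<in> S j' \<longleftrightarrow> j = j'" if "l \<in> S j" for l j j'
    using assms(6) that by (auto simp: disjoint_family_on_def)
  have block: "\<exists>j. l \<in> S j" for l
    using assms(5) by blast

  have "column_stochastic A"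
    unfolding column_stochastic_def
  proof (intro allI conjI)
    fix l :: 'q
    obtain j where "l \<in> S j"
      using block by blast
    then show "(\<Sum>j'\<in>UNIV. A $ j' $ l) = 1"
      by (simp add: A_def mem_iff)
  qed (simp add: A_def)

  moreover have "(norm (mat 1 - B ** A))\<^sup>2 = (\<Sum>j\<in>UNIV. real (qs j) - 1)"
  proof -
    have BA: "(B ** A) $ i $ l = (if l \<in> S j then 1 / real (card (S j)) else 0)"
      if "i \<in> S j" for i j l
    proof -
      have "(B ** A) $ i $ l = (\<Sum>j'\<in>UNIV. if j = j' then (1 / real (qs j)) * A $ j $ l else 0)"
        unfolding matrix_matrix_mult_def vec_lambda_beta
        by (intro sum.cong) (auto simp: center_column_entry[OF assms(8)] mem_iff[OF that])
      then show ?thesis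
        by (simp add: A_def assms(7))
    qed
    have row: "(\<Sum>l\<in>UNIV. ((mat 1 - B ** A) $ i $ l)\<^sup>2) = 1 - 1 / real (card (S j))"
      if "i \<in> S j" for i j
      using dist_vertex_center_sq[OF that] by (simp add: BA[OF that] mat_def)
    have "(norm (mat 1 - B ** A))\<^sup>2
            = (\<Sum>i\<in>(\<Union>j. S j). \<Sum>l\<in>UNIV. ((mat 1 - B ** A) $ i $ l)\<^sup>2)"
      by (simp only: norm_matrix_sq assms(5))
    also have "\<dots> = (\<Sum>j\<in>UNIV. \<Sum>i\<in>S j. \<Sum>l\<in>UNIV. ((mat 1 - B ** A) $ i $ l)\<^sup>2)"
      using assms(6) by (intro sum.UNION_disjoint) (auto simp: disjoint_family_on_def)
    also have "\<dots> = (\<Sum>j\<in>UNIV. real (qs j) * (1 - 1 / real (qs j)))"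
      by (simp only: row sum_constant assms(7) cong: sum.cong)
    also have "\<dots> = (\<Sum>j\<in>UNIV. real (qs j) - 1)"
    proof (intro sum.cong refl)
      fix j
      show "real (qs j) * (1 - 1 / real (qs j)) = real (qs j) - 1"
        using assms(3)[of j] by (simp add: field_simps)
    qed
    finally show ?thesis .
  qed

  moreover have "(\<Sum>j\<in>UNIV. real (qs j) - 1) = real CARD('q) - real CARD('k)"
    by (simp add: assms(4) sum_subtractf)

  ultimately show ?thesis
    by blast
qed

end
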